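(* Let $\mathcal{C}$ be an additive category, $\mathcal{D}$ an exact structure on $\mathcal{C}$, and $(\mathcal{A},\mathcal{B})$ a $\mathcal{D}$-cotorsion pair. Assume that $\mathcal{C}$ has enough $\mathcal{D}$-injectives and enough $\mathcal{D}$-projectives. View $\mathcal{B}$ as the class of $\mathcal{D}$-$\mathcal{E}$-divisible objects of $\mathcal{C}$ for some exact structure $\mathcal{E}$ which is $\mathcal{D}$-projectively generated by a class of objects $\mathcal{N}$, and $\mathcal{A}$ as the class of $\mathcal{D}$-$\mathcal{E}'$-flat objects of $\mathcal{C}$ for some exact structure $\mathcal{E}'$ which is $\mathcal{D}$-injectively generated by a class of objects $\mathcal{M}$. Then the following are equivalent: (i) $\mathcal{B}$ is $\mathcal{D}$-coresolving. (ii) For every $\mathcal{D}$-conflation $Z\rightarrowtail U\twoheadrightarrow V$ in $\mathcal{C}$ with $V\in\mathcal{N}$ and $U$ $\mathcal{D}$-projective, $Z\in\mathcal{A}$. (iii) $\mathcal{A}$ is $\mathcal{D}$-resolving. (iv) For every $\mathcal{D}$-conflation $X\rightarrowtail Y'\twoheadrightarrow Z'$ in $\mathcal{C}$ with $X\in\mathcal{M}$ and $Y'$ $\mathcal{D}$-injective, $Z'\in\mathcal{B}$.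
   Context: An exact structure $\mathcal{E}$ on an additive category $\mathcal{C}$ (Quillen, with Keller's axioms) is a distinguished class of kernel-cokernel pairs $X\rightarrowtail Y\twoheadrightarrow Z$, called $\mathcal{E}$-conflations (their kernels are $\mathcal{E}$-inflations, their cokernels $\mathcal{E}$-deflations), such that: $1_0$ is a deflation; deflations are closed under composition; pullbacks of deflations along arbitrary morphisms exist and are deflations; pushouts of inflations along arbitrary morphisms exist and are inflations. $\mathrm{Ext}^1_{\mathcal{D}}(Z,X)=0$ iff every $\mathcal{D}$-conflation $X\rightarrowtail Y\twoheadrightarrow Z$ splits. A $\mathcal{D}$-cotorsion pair is a pair $(\mathcal{A},\mathcal{B})$ of classes of objects with $\mathcal{B}=\{X\mid \mathrm{Ext}^1_{\mathcal{D}}(A,X)=0\ \forall A\in\mathcal{A}\}$ and $\mathcal{A}=\{X\mid \mathrm{Ext}^1_{\mathcal{D}}(X,B)=0\ \forall B\in\mathcal{B}\}$. An object is $\mathcal{D}$-injective (resp. $\mathcal{D}$-projective) if every $\mathcal{D}$-conflation starting (resp. ending) with it splits. $\mathcal{C}$ has enough $\mathcal{D}$-injectives if every object $X$ admits a $\mathcal{D}$-conflation $X\rightarrowtail Y\twoheadrightarrow Z$ with $Y$ $\mathcal{D}$-injective, and enough $\mathcal{D}$-projectives if every object $Z$ admits a $\mathcal{D}$-conflation $X\rightarrowtail Y\twoheadrightarrow Z$ with $Y$ $\mathcal{D}$-projective. The exact structure $\mathcal{D}$-projectively generated by a class $\mathcal{N}$ of objects consists of the $\mathcal{D}$-conflations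 $X\to Y\to Z$ such that $0\to\mathrm{Hom}(N,X)\to\mathrm{Hom}(N,Y)\to\mathrm{Hom}(N,Z)\to 0$ is exact for every $N\in\mathcal{N}$; the exact structure $\mathcal{D}$-injectively generated by a class $\mathcal{M}$ consists of the $\mathcal{D}$-conflations $X\to Y\to Z$ such that $0\to\mathrm{Hom}(Z,M)\to\mathrm{Hom}(Y,M)\to\mathrm{Hom}(X,M)\to 0$ is exact for every $M\in\mathcal{M}$. An object $X$ is $\mathcal{D}$-$\mathcal{E}$-divisible if every $\mathcal{D}$-inflation $X\rightarrowtail Y$ is an $\mathcal{E}$-inflation, and $\mathcal{D}$-$\mathcal{E}$-flat if every $\mathcal{D}$-deflation $Y\twoheadrightarrow X$ is an $\mathcal{E}$-deflation. A class $\mathcal{K}$ of objects is $\mathcal{D}$-resolving (resp. $\mathcal{D}$-coresolving) if it contains all $\mathcal{D}$-projective (resp. $\mathcal{D}$-injective) objects, is closed under $\mathcal{D}$-extensions (i.e. for every $\mathcal{D}$-conflation $X\rightarrowtail Y\twoheadrightarrow Z$ with $X,Z\in\mathcal{K}$ one has $Y\in\mathcal{K}$), and for every $\mathcal{D}$-conflation $X\rightarrowtail Y\twoheadrightarrow Z$ with $Y,Z\in\mathcal{K}$ (resp. $X,Y\in\mathcal{K}$) one has $X\in\mathcal{K}$ (resp. $Z\in\mathcal{K}$). *)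

theory Defs
  imports "HOL-Algebra.Exact_Sequence" "HOL-Algebra.Ring"
begin

section \<open>Additive categories\<close>

text \<open>
  The Hom-groups are additive groups in the sense of the locale \<^locale>\<open>abelian_group\<close>; hence
  they have type \<open>'m ring\<close>, and the fields \<open>mult\<close> and \<open>one\<close> are never used.
  Composition is written in the order of functions: \<open>g \<bullet> f\<close> is \<open>g\<close> after \<open>f\<close>.
\<close>

record ('o, 'm) add_cat =
  Obj :: "'o set"
  Hom :: "'o \<Rightarrow> 'o \<Rightarrow> 'm ring"
  Comp :: "'m \<Rightarrow> 'm \<Rightarrow> 'm"  (infixl \<open>\<bullet>\<index>\<close> 70)
  Id :: "'o \<Rightarrow> 'm"

definition arr :: "('o, 'm) add_cat \<Rightarrow> 'm \<Rightarrow> 'o \<Rightarrow> 'o \<Rightarrow> bool" where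
  "arr C f X Y \<longleftrightarrow> X \<in> Obj C \<and> Y \<in> Obj C \<and> f \<in> carrier (Hom C X Y)"

text \<open>
  A morphism determines its domain and codomain (\<open>hom_disjoint\<close>), so that composition and
  kernel-cokernel pairs need not carry objects.
\<close>

locale category =
  fixes C :: "('o, 'm) add_cat" (structure)
  assumes hom_disjoint: "arr C f X Y \<Longrightarrow> arr C f X' Y' \<Longrightarrow> X = X' \<and> Y = Y'"
    and id_arr: "X \<in> Obj C \<Longrightarrow> arr C (Id C X) X X"
    and comp_arr: "arr C f X Y \<Longrightarrow> arr C g Y Z \<Longrightarrow> arr C (g \<bullet> f) X Z"
    and id_left: "arr C f X Y \<Longrightarrow> Id C Y \<bullet> f = f"
    and id_right: "arr C f X Y \<Longrightarrow> f \<bullet> Id C X = f"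
    and comp_assoc:
      "arr C f W X \<Longrightarrow> arr C g X Y \<Longrightarrow> arr C h Y Z \<Longrightarrow> (h \<bullet> g) \<bullet> f = h \<bullet> (g \<bullet> f)"

locale preadditive_category = category +
  assumes hom_abelian: "X \<in> Obj C \<Longrightarrow> Y \<in> Obj C \<Longrightarrow> abelian_group (Hom C X Y)"
    and comp_add_right:
      "arr C f X Y \<Longrightarrow> arr C f' X Y \<Longrightarrow> arr C g Y Z \<Longrightarrow>
        g \<bullet> (f \<oplus>\<^bsub>Hom C X Y\<^esub> f') = (g \<bullet> f) \<oplus>\<^bsub>Hom C X Z\<^esub> (g \<bullet> f')"
    and comp_add_left:
      "arr C f X Y \<Longrightarrow> arr C g Y Z \<Longrightarrow> arr C g' Y Z \<Longrightarrow>
        (g \<oplus>\<^bsub>Hom C Y Z\<^esub> g') \<bullet> f = (g \<bullet> f) \<oplus>\<^bsub>Hom C X Z\<^esub> (g' \<bullet> f)"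

definition zero_object :: "('o, 'm) add_cat \<Rightarrow> 'o \<Rightarrow> bool" where
  "zero_object C T \<longleftrightarrow> T \<in> Obj C \<and>
     (\<forall>X \<in> Obj C. (\<exists>!f. arr C f X T) \<and> (\<exists>!f. arr C f T X))"

definition biproduct ::
  "('o, 'm) add_cat \<Rightarrow> 'o \<Rightarrow> 'o \<Rightarrow> 'o \<Rightarrow> 'm \<Rightarrow> 'm \<Rightarrow> 'm \<Rightarrow> 'm \<Rightarrow> bool" where
  "biproduct C X Y S i\<^sub>1 i\<^sub>2 p\<^sub>1 p\<^sub>2 \<longleftrightarrow>
     arr C i\<^sub>1 X S \<and> arr C i\<^sub>2 Y S \<and> arr C p\<^sub>1 S X \<and> arr C p\<^sub>2 S Y \<and>
     p\<^sub>1 \<bullet>\<^bsub>C\<^esub> i\<^sub>1 = Id C X \<and> p\<^sub>2 \<bullet>\<^bsub>C\<^esub> i\<^sub>2 = Id C Y \<and>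
     p\<^sub>2 \<bullet>\<^bsub>C\<^esub> i\<^sub>1 = \<zero>\<^bsub>Hom C X Y\<^esub> \<and> p\<^sub>1 \<bullet>\<^bsub>C\<^esub> i\<^sub>2 = \<zero>\<^bsub>Hom C Y X\<^esub> \<and>
     (i\<^sub>1 \<bullet>\<^bsub>C\<^esub> p\<^sub>1) \<oplus>\<^bsub>Hom C S S\<^esub> (i\<^sub>2 \<bullet>\<^bsub>C\<^esub> p\<^sub>2) = Id C S"

locale additive_category = preadditive_category +
  assumes ex_zero: "\<exists>T. zero_object C T"
    and ex_biproduct: "X \<in> Obj C \<Longrightarrow> Y \<in> Obj C \<Longrightarrow>
      \<exists>S i\<^sub>1 i\<^sub>2 p\<^sub>1 p\<^sub>2. biproduct C X Y S i\<^sub>1 i\<^sub>2 p\<^sub>1 p\<^sub>2"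


section \<open>Exact structures\<close>

definition iso_arr :: "('o, 'm) add_cat \<Rightarrow> 'm \<Rightarrow> 'o \<Rightarrow> 'o \<Rightarrow> bool" where
  "iso_arr C f X Y \<longleftrightarrow> arr C f X Y \<and>
     (\<exists>g. arr C g Y X \<and> g \<bullet>\<^bsub>C\<^esub> f = Id C X \<and> f \<bullet>\<^bsub>C\<^esub> g = Id C Y)"

definition is_kernel :: "('o, 'm) add_cat \<Rightarrow> 'o \<Rightarrow> 'm \<Rightarrow> 'o \<Rightarrow> 'm \<Rightarrow> 'o \<Rightarrow> bool" where
  "is_kernel C X i Y p Z \<longleftrightarrow>
     arr C i X Y \<and> arr C p Y Z \<and> p \<bullet>\<^bsub>C\<^esub> i = \<zero>\<^bsub>Hom C X Z\<^esub> \<and>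
     (\<forall>W g. arr C g W Y \<and> p \<bullet>\<^bsub>C\<^esub> g = \<zero>\<^bsub>Hom C W Z\<^esub> \<longrightarrow>
        (\<exists>!h. arr C h W X \<and> i \<bullet>\<^bsub>C\<^esub> h = g))"

definition is_cokernel :: "('o, 'm) add_cat \<Rightarrow> 'o \<Rightarrow> 'm \<Rightarrow> 'o \<Rightarrow> 'm \<Rightarrow> 'o \<Rightarrow> bool" where
  "is_cokernel C X i Y p Z \<longleftrightarrow>
     arr C i X Y \<and> arr C p Y Z \<and> p \<bullet>\<^bsub>C\<^esub> i = \<zero>\<^bsub>Hom C X Z\<^esub> \<and>
     (\<forall>W g. arr C g Y W \<and> g \<bullet>\<^bsub>C\<^esub> i = \<zero>\<^bsub>Hom C X W\<^esub> \<longrightarrow>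
        (\<exists>!h. arr C h Z W \<and> h \<bullet>\<^bsub>C\<^esub> p = g))"

definition kernel_cokernel_pair ::
  "('o, 'm) add_cat \<Rightarrow> 'o \<Rightarrow> 'm \<Rightarrow> 'o \<Rightarrow> 'm \<Rightarrow> 'o \<Rightarrow> bool" where
  "kernel_cokernel_pair C X i Y p Z \<longleftrightarrow> is_kernel C X i Y p Z \<and> is_cokernel C X i Y p Z"

text \<open>
  In \<open>is_pullback C p f p' f'\<close> and \<open>is_pushout C i f i' f'\<close> the morphism \<open>p'\<close> (\<open>i'\<close>) is the one
  parallel to \<open>p\<close> (\<open>i\<close>) in the square.
\<close>

definition is_pullback :: "('o, 'm) add_cat \<Rightarrow> 'm \<Rightarrow> 'm \<Rightarrow> 'm \<Rightarrow> 'm \<Rightarrow> bool" where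
  "is_pullback C p f p' f' \<longleftrightarrow> (\<exists>Y Z Z' Y'.
     arr C p Y Z \<and> arr C f Z' Z \<and> arr C p' Y' Z' \<and> arr C f' Y' Y \<and>
     p \<bullet>\<^bsub>C\<^esub> f' = f \<bullet>\<^bsub>C\<^esub> p' \<and>
     (\<forall>W u v. arr C u W Y \<and> arr C v W Z' \<and> p \<bullet>\<^bsub>C\<^esub> u = f \<bullet>\<^bsub>C\<^esub> v \<longrightarrow>
        (\<exists>!h. arr C h W Y' \<and> f' \<bullet>\<^bsub>C\<^esub> h = u \<and> p' \<bullet>\<^bsub>C\<^esub> h = v)))"

definition is_pushout :: "('o, 'm) add_cat \<Rightarrow> 'm \<Rightarrow> 'm \<Rightarrow> 'm \<Rightarrow> 'm \<Rightarrow> bool" where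
  "is_pushout C i f i' f' \<longleftrightarrow> (\<exists>X Y X' Y'.
     arr C i X Y \<and> arr C f X X' \<and> arr C i' X' Y' \<and> arr C f' Y Y' \<and>
     f' \<bullet>\<^bsub>C\<^esub> i = i' \<bullet>\<^bsub>C\<^esub> f \<and>
     (\<forall>W u v. arr C u Y W \<and> arr C v X' W \<and> u \<bullet>\<^bsub>C\<^esub> i = v \<bullet>\<^bsub>C\<^esub> f \<longrightarrow>
        (\<exists>!h. arr C h Y' W \<and> h \<bullet>\<^bsub>C\<^esub> f' = u \<and> h \<bullet>\<^bsub>C\<^esub> i' = v)))"

definition conflation ::
  "('o, 'm) add_cat \<Rightarrow> ('m \<times> 'm) set \<Rightarrow> 'o \<Rightarrow> 'm \<Rightarrow> 'o \<Rightarrow> 'm \<Rightarrow> 'o \<Rightarrow> bool" where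
  "conflation C D X i Y p Z \<longleftrightarrow> arr C i X Y \<and> arr C p Y Z \<and> (i, p) \<in> D"

definition inflation :: "('o, 'm) add_cat \<Rightarrow> ('m \<times> 'm) set \<Rightarrow> 'm \<Rightarrow> 'o \<Rightarrow> 'o \<Rightarrow> bool" where
  "inflation C D i X Y \<longleftrightarrow> (\<exists>p Z. conflation C D X i Y p Z)"

definition deflation :: "('o, 'm) add_cat \<Rightarrow> ('m \<times> 'm) set \<Rightarrow> 'm \<Rightarrow> 'o \<Rightarrow> 'o \<Rightarrow> bool" where
  "deflation C D p Y Z \<longleftrightarrow> (\<exists>X i. conflation C D X i Y p Z)"

text \<open>
  As usual, the class of conflations is closed under isomorphisms of kernel-cokernel pairs
  (\<open>iso_closed\<close>).
\<close>

locale exact_structure = additive_category C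
  for C :: "('o, 'm) add_cat" (structure) +
  fixes D :: "('m \<times> 'm) set"
  assumes kernel_cokernel:
      "(i, p) \<in> D \<Longrightarrow> \<exists>X Y Z. kernel_cokernel_pair C X i Y p Z"
    and iso_closed:
      "conflation C D X i Y p Z \<Longrightarrow> arr C i' X' Y' \<Longrightarrow> arr C p' Y' Z' \<Longrightarrow>
        iso_arr C a X X' \<Longrightarrow> iso_arr C b Y Y' \<Longrightarrow> iso_arr C c Z Z' \<Longrightarrow>
        b \<bullet> i = i' \<bullet> a \<Longrightarrow> c \<bullet> p = p' \<bullet> b \<Longrightarrow> conflation C D X' i' Y' p' Z'"
    and zero_deflation: "zero_object C T \<Longrightarrow> deflation C D (Id C T) T T"
    and deflation_comp:
      "deflation C D p X Y \<Longrightarrow> deflation C D q Y Z \<Longrightarrow> deflation C D (q \<bullet> p) X Z"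
    and pullback_exists:
      "deflation C D p Y Z \<Longrightarrow> arr C f Z' Z \<Longrightarrow> \<exists>p' f'. is_pullback C p f p' f'"
    and pullback_deflation:
      "deflation C D p Y Z \<Longrightarrow> arr C f Z' Z \<Longrightarrow> is_pullback C p f p' f' \<Longrightarrow>
        arr C p' Y' Z' \<Longrightarrow> deflation C D p' Y' Z'"
    and pushout_exists:
      "inflation C D i X Y \<Longrightarrow> arr C f X X' \<Longrightarrow> \<exists>i' f'. is_pushout C i f i' f'"
    and pushout_inflation:
      "inflation C D i X Y \<Longrightarrow> arr C f X X' \<Longrightarrow> is_pushout C i f i' f' \<Longrightarrow>
        arr C i' X' Y' \<Longrightarrow> inflation C D i' X' Y'"


section \<open>Relative homological notions\<close>

text \<open>A sequence splits if it is part of a biproduct diagram exhibiting \<open>Y\<close> as \<open>X \<oplus> Z\<close>.\<close>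

definition splits :: "('o, 'm) add_cat \<Rightarrow> 'o \<Rightarrow> 'm \<Rightarrow> 'o \<Rightarrow> 'm \<Rightarrow> 'o \<Rightarrow> bool" where
  "splits C X i Y p Z \<longleftrightarrow> (\<exists>r s. biproduct C X Z Y i s r p)"

definition Ext1_zero :: "('o, 'm) add_cat \<Rightarrow> ('m \<times> 'm) set \<Rightarrow> 'o \<Rightarrow> 'o \<Rightarrow> bool" where
  "Ext1_zero C D Z X \<longleftrightarrow> (\<forall>i Y p. conflation C D X i Y p Z \<longrightarrow> splits C X i Y p Z)"

definition cotorsion_pair ::
  "('o, 'm) add_cat \<Rightarrow> ('m \<times> 'm) set \<Rightarrow> 'o set \<Rightarrow> 'o set \<Rightarrow> bool" where
  "cotorsion_pair C D \<A> \<B> \<longleftrightarrow>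
     \<A> \<subseteq> Obj C \<and> \<B> \<subseteq> Obj C \<and>
     \<B> = {X \<in> Obj C. \<forall>A \<in> \<A>. Ext1_zero C D A X} \<and>
     \<A> = {X \<in> Obj C. \<forall>B \<in> \<B>. Ext1_zero C D X B}"

definition injective_obj :: "('o, 'm) add_cat \<Rightarrow> ('m \<times> 'm) set \<Rightarrow> 'o \<Rightarrow> bool" where
  "injective_obj C D X \<longleftrightarrow> X \<in> Obj C \<and>
     (\<forall>i Y p Z. conflation C D X i Y p Z \<longrightarrow> splits C X i Y p Z)"

definition projective_obj :: "('o, 'm) add_cat \<Rightarrow> ('m \<times> 'm) set \<Rightarrow> 'o \<Rightarrow> bool" where
  "projective_obj C D Z \<longleftrightarrow> Z \<in> Obj C \<and>
     (\<forall>X i Y p. conflation C D X i Y p Z \<longrightarrow> splits C X i Y p Z)"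

definition enough_injectives :: "('o, 'm) add_cat \<Rightarrow> ('m \<times> 'm) set \<Rightarrow> bool" where
  "enough_injectives C D \<longleftrightarrow>
     (\<forall>X \<in> Obj C. \<exists>i Y p Z. conflation C D X i Y p Z \<and> injective_obj C D Y)"

definition enough_projectives :: "('o, 'm) add_cat \<Rightarrow> ('m \<times> 'm) set \<Rightarrow> bool" where
  "enough_projectives C D \<longleftrightarrow>
     (\<forall>Z \<in> Obj C. \<exists>X i Y p. conflation C D X i Y p Z \<and> projective_obj C D Y)"

text \<open>
  Note that \<^const>\<open>short_exact_sequence\<close> takes its groups and maps from right to left.
\<close>

definition projectively_generated ::
  "('o, 'm) add_cat \<Rightarrow> ('m \<times> 'm) set \<Rightarrow> 'o set \<Rightarrow> ('m \<times> 'm) set" where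
  "projectively_generated C D \<N> =
     {(i, p). \<exists>X Y Z. conflation C D X i Y p Z \<and>
        (\<forall>N \<in> \<N>. short_exact_sequence
           (add_monoid (Hom C N Z)) (add_monoid (Hom C N Y)) (add_monoid (Hom C N X))
           (\<lambda>g. p \<bullet>\<^bsub>C\<^esub> g) (\<lambda>f. i \<bullet>\<^bsub>C\<^esub> f))}"

definition injectively_generated ::
  "('o, 'm) add_cat \<Rightarrow> ('m \<times> 'm) set \<Rightarrow> 'o set \<Rightarrow> ('m \<times> 'm) set" where
  "injectively_generated C D \<M> =
     {(i, p). \<exists>X Y Z. conflation C D X i Y p Z \<and>
        (\<forall>M \<in> \<M>. short_exact_sequence
           (add_monoid (Hom C X M)) (add_monoid (Hom C Y M)) (add_monoid (Hom C Z M))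
           (\<lambda>g. g \<bullet>\<^bsub>C\<^esub> i) (\<lambda>f. f \<bullet>\<^bsub>C\<^esub> p))}"

definition divisible_objs ::
  "('o, 'm) add_cat \<Rightarrow> ('m \<times> 'm) set \<Rightarrow> ('m \<times> 'm) set \<Rightarrow> 'o set" where
  "divisible_objs C D E =
     {X \<in> Obj C. \<forall>i Y. inflation C D i X Y \<longrightarrow> inflation C E i X Y}"

definition flat_objs ::
  "('o, 'm) add_cat \<Rightarrow> ('m \<times> 'm) set \<Rightarrow> ('m \<times> 'm) set \<Rightarrow> 'o set" where
  "flat_objs C D E =
     {X \<in> Obj C. \<forall>p Y. deflation C D p Y X \<longrightarrow> deflation C E p Y X}"

definition extension_closed :: "('o, 'm) add_cat \<Rightarrow> ('m \<times> 'm) set \<Rightarrow> 'o set \<Rightarrow> bool" where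
  "extension_closed C D K \<longleftrightarrow>
     (\<forall>X i Y p Z. conflation C D X i Y p Z \<and> X \<in> K \<and> Z \<in> K \<longrightarrow> Y \<in> K)"

definition resolving :: "('o, 'm) add_cat \<Rightarrow> ('m \<times> 'm) set \<Rightarrow> 'o set \<Rightarrow> bool" where
  "resolving C D K \<longleftrightarrow>
     (\<forall>P. projective_obj C D P \<longrightarrow> P \<in> K) \<and> extension_closed C D K \<and>
     (\<forall>X i Y p Z. conflation C D X i Y p Z \<and> Y \<in> K \<and> Z \<in> K \<longrightarrow> X \<in> K)"

definition coresolving :: "('o, 'm) add_cat \<Rightarrow> ('m \<times> 'm) set \<Rightarrow> 'o set \<Rightarrow> bool" where
  "coresolving C D K \<longleftrightarrow>
     (\<forall>I. injective_obj C D I \<longrightarrow> I \<in> K) \<and> extension_closed C D K \<and>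
     (\<forall>X i Y p Z. conflation C D X i Y p Z \<and> X \<in> K \<and> Y \<in> K \<longrightarrow> Z \<in> K)"

end

theory Submission
  imports Defs
begin

text \<open>
  If \<open>Ext\<^sup>1(Z, X) = 0\<close>, every morphism \<open>Z \<rightarrow> W\<close> lifts along a conflation \<open>X \<rightarrow> Y \<rightarrow> W\<close> (pull back and
  split); conversely, if \<open>Y\<close> is injective, then this lifting property implies \<open>Ext\<^sup>1(Z, X) = 0\<close>.
  These facts and their duals replace the long exact sequences for \<open>Ext\<close>. They give
  \<open>\<B> = \<N>\<^sup>\<bottom>\<close>, that \<open>\<B>\<close> is coresolving when the syzygies of the objects of \<open>\<N>\<close> lie in
  \<open>\<A>\<close>, and that \<open>\<A>\<close> is resolving when \<open>\<B>\<close> is coresolving, whence \<open>\<A>\<close> contains these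
  syzygies. The other half of the theorem is the same statement in the opposite category. Keller's
  axioms are not visibly self-dual, because only deflations are assumed to be closed under
  composition; but composition is never used, so the argument is carried out for the self-dual part
  of the axioms.
\<close>

section \<open>Preadditive categories\<close>

context preadditive_category
begin

lemma arr_Obj: "arr C f X Y \<Longrightarrow> X \<in> Obj C \<and> Y \<in> Obj C"
  by (simp add: arr_def)

lemma hom_group: "arr C f X Y \<Longrightarrow> abelian_group (Hom C X Y)"
  using hom_abelian by (simp add: arr_def)

lemma zero_arr: "X \<in> Obj C \<Longrightarrow> Y \<in> Obj C \<Longrightarrow> arr C \<zero>\<^bsub>Hom C X Y\<^esub> X Y"
  using hom_abelian[of X Y] abelian_group.axioms(1) abelian_monoid.zero_closed
  by (fastforce simp: arr_def)

lemma add_arr: "arr C f X Y \<Longrightarrow> arr C g X Y \<Longrightarrow> arr C (f \<oplus>\<^bsub>Hom C X Y\<^esub> g) X Y"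
  using hom_group[of f X Y] abelian_group.axioms(1) abelian_monoid.a_closed
  by (fastforce simp: arr_def)

lemma diff_arr: "arr C f X Y \<Longrightarrow> arr C g X Y \<Longrightarrow> arr C (f \<ominus>\<^bsub>Hom C X Y\<^esub> g) X Y"
  using hom_group[of f X Y] abelian_group.minus_closed by (fastforce simp: arr_def)

lemma add_cancel_right:
  assumes "arr C f X Y" "arr C g X Y" "arr C h X Y"
    and "f \<oplus>\<^bsub>Hom C X Y\<^esub> h = g \<oplus>\<^bsub>Hom C X Y\<^esub> h"
  shows "f = g"
proof -
  interpret H: abelian_group "Hom C X Y" using hom_group assms by blast
  show ?thesis using assms by (simp add: arr_def)
qed

lemma diff_add_cancel:
  assumes "arr C f X Y" "arr C g X Y"
  shows "(f \<ominus>\<^bsub>Hom C X Y\<^esub> g) \<oplus>\<^bsub>Hom C X Y\<^esub> g = f"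
proof -
  interpret H: abelian_group "Hom C X Y" using hom_group assms by blast
  show ?thesis using assms by (simp add: arr_def H.minus_eq H.a_assoc H.l_neg)
qed

lemma add_zero_left:
  assumes "arr C f X Y"
  shows "\<zero>\<^bsub>Hom C X Y\<^esub> \<oplus>\<^bsub>Hom C X Y\<^esub> f = f"
proof -
  interpret H: abelian_group "Hom C X Y" using hom_group assms by blast
  show ?thesis using assms by (simp add: arr_def)
qed

lemma add_comm:
  assumes "arr C f X Y" "arr C g X Y"
  shows "f \<oplus>\<^bsub>Hom C X Y\<^esub> g = g \<oplus>\<^bsub>Hom C X Y\<^esub> f"
proof -
  interpret H: abelian_group "Hom C X Y" using hom_group assms by blast
  show ?thesis using assms by (simp add: arr_def H.a_comm)
qed

lemma diff_eq_iff:
  assumes "arr C f X Y" "arr C g X Y" "arr C h X Y"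
  shows "f \<ominus>\<^bsub>Hom C X Y\<^esub> g = h \<longleftrightarrow> f = h \<oplus>\<^bsub>Hom C X Y\<^esub> g"
  using diff_add_cancel[OF assms(1,2)] add_cancel_right[OF diff_arr[OF assms(1,2)] assms(3,2)]
  by metis

lemma diff_eq_zero_iff:
  assumes "arr C f X Y" "arr C g X Y"
  shows "f \<ominus>\<^bsub>Hom C X Y\<^esub> g = \<zero>\<^bsub>Hom C X Y\<^esub> \<longleftrightarrow> f = g"
  using diff_eq_iff[OF assms zero_arr] arr_Obj[OF assms(1)] add_zero_left[OF assms(2)] by simp

lemma diff_zero:
  assumes "arr C f X Y"
  shows "f \<ominus>\<^bsub>Hom C X Y\<^esub> \<zero>\<^bsub>Hom C X Y\<^esub> = f"
  using diff_eq_iff[OF assms zero_arr assms] arr_Obj[OF assms] add_comm[OF assms zero_arr]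
    add_zero_left[OF assms] by simp

lemma comp_zero_right:
  assumes "arr C g Y Z" "X \<in> Obj C"
  shows "g \<bullet> \<zero>\<^bsub>Hom C X Y\<^esub> = \<zero>\<^bsub>Hom C X Z\<^esub>"
proof -
  have O: "X \<in> Obj C" "Y \<in> Obj C" "Z \<in> Obj C" using assms arr_Obj by auto
  have z: "arr C \<zero>\<^bsub>Hom C X Y\<^esub> X Y" "arr C \<zero>\<^bsub>Hom C X Z\<^esub> X Z" using zero_arr O by auto
  have gz: "arr C (g \<bullet> \<zero>\<^bsub>Hom C X Y\<^esub>) X Z" using comp_arr[OF z(1) assms(1)] .
  have "(g \<bullet> \<zero>\<^bsub>Hom C X Y\<^esub>) \<oplus>\<^bsub>Hom C X Z\<^esub> (g \<bullet> \<zero>\<^bsub>Hom C X Y\<^esub>) = g \<bullet> \<zero>\<^bsub>Hom C X Y\<^esub>"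
    using comp_add_right[OF z(1) z(1) assms(1)] add_zero_left[OF z(1)] by simp
  then show ?thesis
    using add_cancel_right[OF gz z(2) gz] add_zero_left[OF gz] by simp
qed

lemma comp_diff_right:
  assumes "arr C f X Y" "arr C f' X Y" "arr C g Y Z"
  shows "g \<bullet> (f \<ominus>\<^bsub>Hom C X Y\<^esub> f') = (g \<bullet> f) \<ominus>\<^bsub>Hom C X Z\<^esub> (g \<bullet> f')"
  using comp_add_right[OF diff_arr[OF assms(1,2)] assms(2,3)] diff_add_cancel[OF assms(1,2)]
    diff_eq_iff[OF comp_arr[OF assms(1,3)] comp_arr[OF assms(2,3)]
      comp_arr[OF diff_arr[OF assms(1,2)] assms(3)]]
  by simp

end


section \<open>The opposite category\<close>

text \<open>Morphisms and their Hom-groups stay the same and only domain and codomain change places,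
  so sums and zeros need no translation. The converse \<open>D\<inverse>\<close> takes the role of
  \<open>D\<close>, because a conflation is read backwards.\<close>

definition opposite :: "('o, 'm) add_cat \<Rightarrow> ('o, 'm) add_cat" where
  "opposite C = \<lparr>Obj = Obj C, Hom = \<lambda>X Y. Hom C Y X, Comp = \<lambda>g f. f \<bullet>\<^bsub>C\<^esub> g, Id = Id C\<rparr>"

lemma opposite_simps [simp]:
  "Obj (opposite C) = Obj C"
  "Hom (opposite C) X Y = Hom C Y X"
  "g \<bullet>\<^bsub>opposite C\<^esub> f = f \<bullet>\<^bsub>C\<^esub> g"
  "Id (opposite C) = Id C"
  by (simp_all add: opposite_def)

lemma arr_opposite [simp]: "arr (opposite C) f X Y = arr C f Y X"
  by (auto simp: arr_def)

lemma (in preadditive_category) preadditive_opposite: "preadditive_category (opposite C)"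
proof (intro preadditive_category.intro category.intro preadditive_category_axioms.intro)
  fix f X Y X' Y'
  show "arr (opposite C) f X Y \<Longrightarrow> arr (opposite C) f X' Y' \<Longrightarrow> X = X' \<and> Y = Y'"
    using hom_disjoint by (metis arr_opposite)
next
  fix f g h W X Y Z
  assume "arr (opposite C) f W X" "arr (opposite C) g X Y" "arr (opposite C) h Y Z"
  then show "h \<bullet>\<^bsub>opposite C\<^esub> g \<bullet>\<^bsub>opposite C\<^esub> f = h \<bullet>\<^bsub>opposite C\<^esub> (g \<bullet>\<^bsub>opposite C\<^esub> f)"
    using comp_assoc by simp
qed (auto simp: id_arr id_left id_right hom_abelian
      intro: comp_arr comp_add_right comp_add_left)

context preadditive_category
begin

lemma comp_zero_left:
  assumes "arr C f X Y" "Z \<in> Obj C"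
  shows "\<zero>\<^bsub>Hom C Y Z\<^esub> \<bullet> f = \<zero>\<^bsub>Hom C X Z\<^esub>"
  using preadditive_category.comp_zero_right[OF preadditive_opposite] assms by fastforce

lemma comp_diff_left:
  assumes "arr C f X Y" "arr C g Y Z" "arr C g' Y Z"
  shows "(g \<ominus>\<^bsub>Hom C Y Z\<^esub> g') \<bullet> f = (g \<bullet> f) \<ominus>\<^bsub>Hom C X Z\<^esub> (g' \<bullet> f)"
  using preadditive_category.comp_diff_right[OF preadditive_opposite, of g Z Y g' f X] assms by simp

end

lemma iso_arr_opposite: "iso_arr (opposite C) f X Y \<longleftrightarrow> iso_arr C f Y X"
  by (auto simp: iso_arr_def)

lemma kernel_cokernel_pair_opposite:
  "kernel_cokernel_pair (opposite C) Z p Y i X \<longleftrightarrow> kernel_cokernel_pair C X i Y p Z"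
  unfolding kernel_cokernel_pair_def is_kernel_def is_cokernel_def by auto

lemma is_pullback_opposite: "is_pullback (opposite C) p f p' f' \<longleftrightarrow> is_pushout C p f p' f'"
  unfolding is_pullback_def is_pushout_def by (simp, blast)

lemma is_pushout_opposite: "is_pushout (opposite C) p f p' f' \<longleftrightarrow> is_pullback C p f p' f'"
  unfolding is_pullback_def is_pushout_def by (simp, blast)

lemma conflation_opposite [simp]:
  "conflation (opposite C) (D\<inverse>) Z p Y i X \<longleftrightarrow> conflation C D X i Y p Z"
  by (auto simp: conflation_def)

lemma inflation_opposite [simp]: "inflation (opposite C) (D\<inverse>) p Z Y \<longleftrightarrow> deflation C D p Y Z"
  by (auto simp: inflation_def deflation_def)

lemma deflation_opposite [simp]: "deflation (opposite C) (D\<inverse>) i Y X \<longleftrightarrow> inflation C D i X Y"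
  by (auto simp: inflation_def deflation_def)


section \<open>The self-dual part of the axioms of an exact structure\<close>

text \<open>Each axiom is its own dual or occurs together with its dual. Hence
  \<open>opposite C\<close> with \<open>D\<inverse>\<close> is again an instance, and every
  statement proved here can be dualized by instantiation.\<close>

locale pre_exact_structure = preadditive_category C
  for C :: "('o, 'm) add_cat" (structure) +
  fixes D :: "('m \<times> 'm) set"
  assumes kernel_cokernel:
      "(i, p) \<in> D \<Longrightarrow> \<exists>X Y Z. kernel_cokernel_pair C X i Y p Z"
    and iso_closed:
      "conflation C D X i Y p Z \<Longrightarrow> arr C i' X' Y' \<Longrightarrow> arr C p' Y' Z' \<Longrightarrow>
        iso_arr C a X X' \<Longrightarrow> iso_arr C b Y Y' \<Longrightarrow> iso_arr C c Z Z' \<Longrightarrow>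
        b \<bullet> i = i' \<bullet> a \<Longrightarrow> c \<bullet> p = p' \<bullet> b \<Longrightarrow> conflation C D X' i' Y' p' Z'"
    and pullback_exists:
      "deflation C D p Y Z \<Longrightarrow> arr C f Z' Z \<Longrightarrow> \<exists>p' f'. is_pullback C p f p' f'"
    and pullback_deflation:
      "deflation C D p Y Z \<Longrightarrow> arr C f Z' Z \<Longrightarrow> is_pullback C p f p' f' \<Longrightarrow>
        arr C p' Y' Z' \<Longrightarrow> deflation C D p' Y' Z'"
    and pushout_exists:
      "inflation C D i X Y \<Longrightarrow> arr C f X X' \<Longrightarrow> \<exists>i' f'. is_pushout C i f i' f'"
    and pushout_inflation:
      "inflation C D i X Y \<Longrightarrow> arr C f X X' \<Longrightarrow> is_pushout C i f i' f' \<Longrightarrow>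
        arr C i' X' Y' \<Longrightarrow> inflation C D i' X' Y'"

lemma (in exact_structure) pre_exact: "pre_exact_structure C D"
  by unfold_locales
    (fact kernel_cokernel iso_closed pullback_exists pullback_deflation pushout_exists
      pushout_inflation)+

text \<open>Multiply the square by the two inverses. This serves to dualize
  \<open>iso_closed\<close>: an isomorphism of conflations changes direction in the opposite
  category, so the axiom has to be applied to the inverse isomorphisms.\<close>

lemma (in preadditive_category) iso_square_inverse:
  assumes "iso_arr C a X X'" "iso_arr C b Y Y'" "arr C f X Y" "arr C f' X' Y'"
    and "b \<bullet> f = f' \<bullet> a"
  and "arr C a' X' X" "a' \<bullet> a = Id C X" "a \<bullet> a' = Id C X'"
  and "arr C b' Y' Y" "b' \<bullet> b = Id C Y" "b \<bullet> b' = Id C Y'"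
  shows "f \<bullet> a' = b' \<bullet> f'"
proof -
  have a: "arr C a X X'" and b: "arr C b Y Y'" using assms by (auto simp: iso_arr_def)
  have "b' \<bullet> f' = b' \<bullet> (f' \<bullet> (a \<bullet> a'))" using assms id_right by simp
  also have "\<dots> = b' \<bullet> ((b \<bullet> f) \<bullet> a')" using comp_assoc[OF assms(6) a assms(4)] assms(5) by simp
  also have "\<dots> = (b' \<bullet> b) \<bullet> (f \<bullet> a')"
    using comp_assoc[OF assms(6,3) b] comp_assoc[OF comp_arr[OF assms(6,3)] b assms(9)] by simp
  also have "\<dots> = f \<bullet> a'" using id_left[OF comp_arr[OF assms(6,3)]] assms by simp
  finally show ?thesis by simp
qed

context pre_exact_structure
begin

lemma pre_exact_opposite: "pre_exact_structure (opposite C) (D\<inverse>)"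
proof -
  interpret op: preadditive_category "opposite C" by (rule preadditive_opposite)
  show ?thesis
  proof
    fix i p assume "(i, p) \<in> D\<inverse>"
    then show "\<exists>X Y Z. kernel_cokernel_pair (opposite C) X i Y p Z"
      using kernel_cokernel kernel_cokernel_pair_opposite by (metis converse_iff)
  next
    fix X i Y p Z i' X' Y' p' Z' a b c
    assume c: "conflation (opposite C) (D\<inverse>) X i Y p Z"
      and i': "arr (opposite C) i' X' Y'" and p': "arr (opposite C) p' Y' Z'"
      and iso: "iso_arr (opposite C) a X X'" "iso_arr (opposite C) b Y Y'" "iso_arr (opposite C) c Z Z'"
      and sq: "b \<bullet>\<^bsub>opposite C\<^esub> i = i' \<bullet>\<^bsub>opposite C\<^esub> a" "c \<bullet>\<^bsub>opposite C\<^esub> p = p' \<bullet>\<^bsub>opposite C\<^esub> b"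
    obtain a' where a': "arr C a' X X'" "a' \<bullet> a = Id C X'" "a \<bullet> a' = Id C X"
      using iso(1) by (auto simp: iso_arr_def)
    obtain b' where b': "arr C b' Y Y'" "b' \<bullet> b = Id C Y'" "b \<bullet> b' = Id C Y"
      using iso(2) by (auto simp: iso_arr_def)
    obtain c' where c': "arr C c' Z Z'" "c' \<bullet> c = Id C Z'" "c \<bullet> c' = Id C Z"
      using iso(3) by (auto simp: iso_arr_def)
    have iso': "iso_arr C a X' X" "iso_arr C b Y' Y" "iso_arr C c Z' Z"
      using iso by (auto simp: iso_arr_opposite)
    have D: "conflation C D Z p Y i X" using c by simp
    have ip: "arr C i Y X" "arr C p Z Y" using D by (auto simp: conflation_def)
    have "i' \<bullet> b' = a' \<bullet> i"
      using iso_square_inverse[OF iso'(2,1) _ ip(1) _ b' a', of i'] i' sq by simp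
    moreover have "p' \<bullet> c' = b' \<bullet> p"
      using iso_square_inverse[OF iso'(3,2) _ ip(2) _ c' b', of p'] p' sq by simp
    moreover have "iso_arr C a' X X'" "iso_arr C b' Y Y'" "iso_arr C c' Z Z'"
      using a' b' c' iso' by (auto simp: iso_arr_def)
    ultimately have "conflation C D Z' p' Y' i' X'"
      using iso_closed[OF D, of p' Z' Y' i' X' c' b' a'] i' p' by simp
    then show "conflation (opposite C) (D\<inverse>) X' i' Y' p' Z'" by simp
  next
    fix p Y Z f Z'
    assume "deflation (opposite C) (D\<inverse>) p Y Z" "arr (opposite C) f Z' Z"
    then show "\<exists>p' f'. is_pullback (opposite C) p f p' f'"
      using pushout_exists by (simp add: is_pullback_opposite)
  next
    fix p Y Z f Z' p' f' Y'
    assume "deflation (opposite C) (D\<inverse>) p Y Z" "arr (opposite C) f Z' Z"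
      "is_pullback (opposite C) p f p' f'" "arr (opposite C) p' Y' Z'"
    then show "deflation (opposite C) (D\<inverse>) p' Y' Z'"
      using pushout_inflation by (simp add: is_pullback_opposite)
  next
    fix p Y Z f Z'
    assume "inflation (opposite C) (D\<inverse>) p Y Z" "arr (opposite C) f Y Z'"
    then show "\<exists>p' f'. is_pushout (opposite C) p f p' f'"
      using pullback_exists by (simp add: is_pushout_opposite)
  next
    fix p Y Z f Z' p' f' Y'
    assume "inflation (opposite C) (D\<inverse>) p Y Z" "arr (opposite C) f Y Z'"
      "is_pushout (opposite C) p f p' f'" "arr (opposite C) p' Z' Y'"
    then show "inflation (opposite C) (D\<inverse>) p' Z' Y'"
      using pullback_deflation by (simp add: is_pushout_opposite)
  qed
qed

text \<open>The axiom \<open>kernel_cokernel\<close> provides some objects only;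
  \<open>hom_disjoint\<close> identifies them with the given ones.\<close>

lemma conflation_pair: "conflation C D X i Y p Z \<Longrightarrow> kernel_cokernel_pair C X i Y p Z"
  using kernel_cokernel[of i p] hom_disjoint
  unfolding conflation_def kernel_cokernel_pair_def is_kernel_def by metis

lemma conflation_arr:
  assumes "conflation C D X i Y p Z"
  shows "arr C i X Y" "arr C p Y Z"
  using assms by (auto simp: conflation_def)

lemma conflation_Obj:
  assumes "conflation C D X i Y p Z"
  shows "X \<in> Obj C" "Y \<in> Obj C" "Z \<in> Obj C"
  using assms by (auto simp: conflation_def arr_def)

lemma conflation_comp_zero: "conflation C D X i Y p Z \<Longrightarrow> p \<bullet> i = \<zero>\<^bsub>Hom C X Z\<^esub>"
  using conflation_pair by (fastforce simp: kernel_cokernel_pair_def is_kernel_def)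

lemma conflation_kernel:
  assumes "conflation C D X i Y p Z" "arr C g W Y" "p \<bullet> g = \<zero>\<^bsub>Hom C W Z\<^esub>"
  obtains h where "arr C h W X" "i \<bullet> h = g"
  using conflation_pair[OF assms(1)] assms unfolding kernel_cokernel_pair_def is_kernel_def by blast

lemma conflation_cokernel:
  assumes "conflation C D X i Y p Z" "arr C g Y W" "g \<bullet> i = \<zero>\<^bsub>Hom C X W\<^esub>"
  obtains h where "arr C h Z W" "h \<bullet> p = g"
  using conflation_pair[OF assms(1)] assms unfolding kernel_cokernel_pair_def is_cokernel_def by blast

text \<open>Both morphisms factor \<open>i \<bullet> h\<close> through the kernel \<open>i\<close>
  of \<open>p\<close>, and such a factorization is unique.\<close>

lemma inflation_mono:
  assumes "conflation C D X i Y p Z" "arr C h W X" "arr C h' W X" "i \<bullet> h = i \<bullet> h'"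
  shows "h = h'"
proof -
  have a: "arr C i X Y" "arr C p Y Z" using conflation_arr assms by auto
  have "p \<bullet> (i \<bullet> h) = \<zero>\<^bsub>Hom C W Z\<^esub>"
    using comp_assoc[OF assms(2) a] conflation_comp_zero[OF assms(1)]
      comp_zero_left[OF assms(2)] conflation_Obj[OF assms(1)] by simp
  moreover have "arr C (i \<bullet> h) W Y" using comp_arr a assms by blast
  ultimately have "\<exists>!k. arr C k W X \<and> i \<bullet> k = i \<bullet> h"
    using conflation_pair[OF assms(1)] unfolding kernel_cokernel_pair_def is_kernel_def by simp
  then show ?thesis using assms by metis
qed

lemma deflation_epi:
  assumes "conflation C D X i Y p Z" "arr C h Z W" "arr C h' Z W" "h \<bullet> p = h' \<bullet> p"
  shows "h = h'"
  using pre_exact_structure.inflation_mono[OF pre_exact_opposite, of Z p Y i X h W h'] assms by simp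

text \<open>The two kernels of \<open>p\<close> factor through each other by mutually inverse
  morphisms \<open>u\<close> and \<open>v\<close>; closure under isomorphisms, with identities on
  \<open>Y\<close> and \<open>Z\<close>, does the rest.\<close>

lemma kernel_replace:
  assumes c: "conflation C D X i Y p Z" and k: "is_kernel C X' i' Y p Z"
  shows "conflation C D X' i' Y p Z"
proof -
  have a: "arr C i X Y" "arr C p Y Z" "arr C i' X' Y" "p \<bullet> i' = \<zero>\<^bsub>Hom C X' Z\<^esub>"
    using conflation_arr c k by (auto simp: is_kernel_def)
  obtain u where u: "arr C u X' X" "i \<bullet> u = i'" using conflation_kernel[OF c a(3,4)] by blast
  have un: "\<exists>!h. arr C h W X' \<and> i' \<bullet> h = g" if "arr C g W Y" "p \<bullet> g = \<zero>\<^bsub>Hom C W Z\<^esub>" for W g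
    using k that by (auto simp: is_kernel_def)
  obtain v where v: "arr C v X X'" "i' \<bullet> v = i"
    using un[OF a(1) conflation_comp_zero[OF c]] by blast
  have O: "X \<in> Obj C" "Y \<in> Obj C" "Z \<in> Obj C" "X' \<in> Obj C" using a arr_Obj by auto
  have "i \<bullet> (u \<bullet> v) = i \<bullet> Id C X"
    using comp_assoc[OF v(1) u(1) a(1)] u v id_right[OF a(1)] by simp
  then have uv: "u \<bullet> v = Id C X"
    using inflation_mono[OF c comp_arr[OF v(1) u(1)] id_arr] O by simp
  have "i' \<bullet> (v \<bullet> u) = i' \<bullet> Id C X'"
    using comp_assoc[OF u(1) v(1) a(3)] u v id_right[OF a(3)] by simp
  then have vu: "v \<bullet> u = Id C X'"
    using un[OF a(3,4)] comp_arr[OF u(1) v(1)] id_arr O id_right[OF a(3)] by metis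
  have "iso_arr C v X X'" using u v uv vu by (auto simp: iso_arr_def)
  moreover have "iso_arr C (Id C W) W W" if "W \<in> Obj C" for W
    using id_arr[OF that] id_left[OF id_arr[OF that]] by (auto simp: iso_arr_def)
  ultimately show ?thesis
    using iso_closed[OF c a(3,2), of v "Id C Y" "Id C Z"] O v id_left[OF a(1)] id_left[OF a(2)]
      id_right[OF a(2)] by simp
qed

text \<open>The axioms make the pullback \<open>p'\<close> a deflation with some kernel. That
  \<open>X\<close> itself is a kernel of \<open>p'\<close> is what allows a hypothesis on extensions
  by \<open>X\<close> to be applied to the pulled back sequence.\<close>

lemma pullback_conflation:
  assumes c: "conflation C D X i Y p W" and f: "arr C f Z W"
  obtains i' Y' p' f' where "conflation C D X i' Y' p' Z" "arr C f' Y' Y" "p \<bullet> f' = f \<bullet> p'"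
proof -
  have a: "arr C i X Y" "arr C p Y W" using conflation_arr c by auto
  have d: "deflation C D p Y W" using c by (auto simp: deflation_def)
  obtain p' f' where pb: "is_pullback C p f p' f'" using pullback_exists[OF d f] by blast
  then obtain Y\<^sub>0 Z\<^sub>0 Z\<^sub>1 Y' where
    pb': "arr C p Y\<^sub>0 Z\<^sub>0" "arr C f Z\<^sub>1 Z\<^sub>0" "arr C p' Y' Z\<^sub>1" "arr C f' Y' Y\<^sub>0"
     "p \<bullet> f' = f \<bullet> p'"
     "\<forall>W u v. arr C u W Y\<^sub>0 \<and> arr C v W Z\<^sub>1 \<and> p \<bullet> u = f \<bullet> v \<longrightarrow>
        (\<exists>!h. arr C h W Y' \<and> f' \<bullet> h = u \<and> p' \<bullet> h = v)"
    unfolding is_pullback_def by blast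
  have "Y\<^sub>0 = Y" "Z\<^sub>0 = W" "Z\<^sub>1 = Z" using hom_disjoint pb'(1,2) a(2) f by metis+
  note pb' = pb'[unfolded this]
  have univ: "\<exists>!h. arr C h V Y' \<and> f' \<bullet> h = u \<and> p' \<bullet> h = v"
    if "arr C u V Y" "arr C v V Z" "p \<bullet> u = f \<bullet> v" for V u v
    using pb'(6) that by blast
  have O: "X \<in> Obj C" "Z \<in> Obj C" "W \<in> Obj C" using a f arr_Obj by auto
  obtain X' k where k: "conflation C D X' k Y' p' Z"
    using pullback_deflation[OF d f pb pb'(3)] by (auto simp: deflation_def)
  \<comment> \<open>The morphisms \<open>i\<close> into \<open>Y\<close> and zero into
    \<open>Z\<close> are compatible with the square and so induce the embedding \<open>i'\<close> of
    \<open>X\<close> into the pullback.\<close>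
  have "p \<bullet> i = f \<bullet> \<zero>\<^bsub>Hom C X Z\<^esub>"
    using conflation_comp_zero[OF c] comp_zero_right[OF f O(1)] by simp
  then obtain i' where i': "arr C i' X Y'" "f' \<bullet> i' = i" "p' \<bullet> i' = \<zero>\<^bsub>Hom C X Z\<^esub>"
    using univ[OF a(1) zero_arr[OF O(1,2)]] by blast
  have "is_kernel C X i' Y' p' Z"
    unfolding is_kernel_def
  proof (intro conjI allI impI)
    fix V g assume "arr C g V Y' \<and> p' \<bullet> g = \<zero>\<^bsub>Hom C V Z\<^esub>"
    then have g: "arr C g V Y'" "p' \<bullet> g = \<zero>\<^bsub>Hom C V Z\<^esub>" by auto
    have V: "V \<in> Obj C" using g arr_Obj by blast
    have fg: "arr C (f' \<bullet> g) V Y" using comp_arr g pb' by blast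
    have z: "p \<bullet> (f' \<bullet> g) = f \<bullet> \<zero>\<^bsub>Hom C V Z\<^esub>"
      using comp_assoc[OF g(1) pb'(4) a(2)] comp_assoc[OF g(1) pb'(3) f] pb'(5) g(2) by simp
    then obtain h where h: "arr C h V X" "i \<bullet> h = f' \<bullet> g"
      using conflation_kernel[OF c fg] comp_zero_right[OF f V] by metis
    have "f' \<bullet> (i' \<bullet> h) = f' \<bullet> g"
      using comp_assoc[OF h(1) i'(1) pb'(4)] i' h by simp
    moreover have "p' \<bullet> (i' \<bullet> h) = \<zero>\<^bsub>Hom C V Z\<^esub>"
      using comp_assoc[OF h(1) i'(1) pb'(3)] i' comp_zero_left[OF h(1) O(2)] by simp
    \<comment> \<open>Both sides have the components \<open>f' \<bullet> g\<close> and zero, so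
      uniqueness in the pullback identifies them.\<close>
    ultimately have "i' \<bullet> h = g"
      using univ[OF fg zero_arr[OF V O(2)] z] comp_arr[OF h(1) i'(1)] g by metis
    moreover have "h' = h" if h': "arr C h' V X" "i' \<bullet> h' = g" for h'
    proof -
      have "i \<bullet> h' = i \<bullet> h" using comp_assoc[OF h'(1) i'(1) pb'(4)] i' h' h by simp
      then show ?thesis using inflation_mono[OF c h'(1) h(1)] by simp
    qed
    ultimately show "\<exists>!h. arr C h V X \<and> i' \<bullet> h = g" using h by blast
  qed (use i' pb' in auto)
  then have "conflation C D X i' Y' p' Z" using kernel_replace[OF k] by simp
  then show thesis using that pb' by blast
qed

end


section \<open>Splitting and lifting\<close>

text \<open>Duality exchanges the two summands in the decomposition of the identity of
  \<open>Y\<close>, so commutativity of addition is what matters.\<close>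

lemma (in preadditive_category) splits_opposite:
  "splits (opposite C) Z p Y i X \<longleftrightarrow> splits C X i Y p Z"
proof -
  have "(i \<bullet> r) \<oplus>\<^bsub>Hom C Y Y\<^esub> (s \<bullet> p) = (s \<bullet> p) \<oplus>\<^bsub>Hom C Y Y\<^esub> (i \<bullet> r)"
    if "arr C i X Y" "arr C r Y X" "arr C s Z Y" "arr C p Y Z" for r s
    using that add_comm comp_arr by blast
  then show ?thesis unfolding splits_def biproduct_def by (simp, metis)
qed

section \<open>Duality of the relative homological notions\<close>

lemma (in preadditive_category) Ext1_zero_opposite:
  "Ext1_zero (opposite C) (D\<inverse>) X Z \<longleftrightarrow> Ext1_zero C D Z X"
  unfolding Ext1_zero_def splits_opposite conflation_opposite by blast

lemma (in preadditive_category) injective_obj_opposite: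
  "injective_obj (opposite C) (D\<inverse>) X \<longleftrightarrow> projective_obj C D X"
  unfolding injective_obj_def projective_obj_def splits_opposite conflation_opposite opposite_simps
  by blast

lemma (in preadditive_category) projective_obj_opposite:
  "projective_obj (opposite C) (D\<inverse>) X \<longleftrightarrow> injective_obj C D X"
  unfolding injective_obj_def projective_obj_def splits_opposite conflation_opposite opposite_simps
  by blast

lemma (in preadditive_category) enough_injectives_opposite:
  "enough_injectives (opposite C) (D\<inverse>) \<longleftrightarrow> enough_projectives C D"
  unfolding enough_injectives_def enough_projectives_def injective_obj_opposite
    conflation_opposite opposite_simps by blast

lemma (in preadditive_category) enough_projectives_opposite:
  "enough_projectives (opposite C) (D\<inverse>) \<longleftrightarrow> enough_injectives C D"
  unfolding enough_injectives_def enough_projectives_def projective_obj_opposite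
    conflation_opposite opposite_simps by blast

lemma injective_obj_Ext1_zero: "injective_obj C D I \<Longrightarrow> Ext1_zero C D Z I"
  by (simp add: injective_obj_def Ext1_zero_def)

lemma projective_obj_Ext1_zero: "projective_obj C D P \<Longrightarrow> Ext1_zero C D P X"
  by (simp add: projective_obj_def Ext1_zero_def)

section \<open>Splitting criteria, and lifting and extending morphisms\<close>

context pre_exact_structure
begin

text \<open>The idempotent \<open>Id C Y\<close> minus \<open>i \<bullet> r\<close> vanishes on
  \<open>i\<close> and therefore factors as \<open>s \<bullet> p\<close>. This \<open>s\<close> is
  the section; the equations for \<open>p \<bullet> s\<close> and \<open>r \<bullet> s\<close> are
  checked after composing with the epimorphism \<open>p\<close>.\<close>

lemma splits_if_retraction:
  assumes c: "conflation C D X i Y p Z" and r: "arr C r Y X" "r \<bullet> i = Id C X"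
  shows "splits C X i Y p Z"
proof -
  have a: "arr C i X Y" "arr C p Y Z" using conflation_arr c by auto
  have O: "X \<in> Obj C" "Y \<in> Obj C" "Z \<in> Obj C" using a arr_Obj by auto
  have ir: "arr C (i \<bullet> r) Y Y" using comp_arr[OF r(1) a(1)] .
  let ?d = "Id C Y \<ominus>\<^bsub>Hom C Y Y\<^esub> (i \<bullet> r)"
  have d: "arr C ?d Y Y" using diff_arr[OF id_arr[OF O(2)] ir] .
  have iri: "(i \<bullet> r) \<bullet> i = i" using comp_assoc[OF a(1) r(1) a(1)] r(2) id_right[OF a(1)] by simp
  have "?d \<bullet> i = \<zero>\<^bsub>Hom C X Y\<^esub>"
    using comp_diff_left[OF a(1) id_arr[OF O(2)] ir] iri id_left[OF a(1)]
      diff_eq_zero_iff[OF a(1) a(1)] by simp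
  then obtain s where s: "arr C s Z Y" "s \<bullet> p = ?d" using conflation_cokernel[OF c d] by metis
  have sp: "arr C (s \<bullet> p) Y Y" using comp_arr[OF a(2) s(1)] .
  have "p \<bullet> (i \<bullet> r) = \<zero>\<^bsub>Hom C Y Z\<^esub>"
    using comp_assoc[OF r(1) a(1) a(2)] conflation_comp_zero[OF c] comp_zero_left[OF r(1) O(3)] by simp
  then have "p \<bullet> ?d = p"
    using comp_diff_right[OF id_arr[OF O(2)] ir a(2)] id_right[OF a(2)] diff_zero[OF a(2)] by simp
  then have "(p \<bullet> s) \<bullet> p = Id C Z \<bullet> p"
    using comp_assoc[OF a(2) s(1) a(2)] s(2) id_left[OF a(2)] by simp
  then have ps: "p \<bullet> s = Id C Z"
    using deflation_epi[OF c comp_arr[OF s(1) a(2)] id_arr[OF O(3)]] by simp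
  have "r \<bullet> (i \<bullet> r) = r" using comp_assoc[OF r(1) a(1) r(1)] r id_left[OF r(1)] by simp
  then have "r \<bullet> ?d = \<zero>\<^bsub>Hom C Y X\<^esub>"
    using comp_diff_right[OF id_arr[OF O(2)] ir r(1)] id_right[OF r(1)]
      diff_eq_zero_iff[OF r(1) r(1)] by simp
  then have "(r \<bullet> s) \<bullet> p = \<zero>\<^bsub>Hom C Z X\<^esub> \<bullet> p"
    using comp_assoc[OF a(2) s(1) r(1)] s(2) comp_zero_left[OF a(2) O(1)] by simp
  then have rs: "r \<bullet> s = \<zero>\<^bsub>Hom C Z X\<^esub>"
    using deflation_epi[OF c comp_arr[OF s(1) r(1)] zero_arr[OF O(3,1)]] by simp
  have "(i \<bullet> r) \<oplus>\<^bsub>Hom C Y Y\<^esub> (s \<bullet> p) = Id C Y"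
    using diff_add_cancel[OF id_arr[OF O(2)] ir] s(2) add_comm[OF ir sp] by simp
  then show ?thesis
    unfolding splits_def biproduct_def
    using a r s ps rs conflation_comp_zero[OF c] by blast
qed

lemma splits_if_section:
  assumes "conflation C D X i Y p Z" "arr C s Z Y" "p \<bullet> s = Id C Z"
  shows "splits C X i Y p Z"
  using pre_exact_structure.splits_if_retraction[OF pre_exact_opposite, of Z p Y i X s] assms
  by (simp add: splits_opposite)

text \<open>The pullback of the conflation along \<open>f\<close> starts with \<open>X\<close> and
  ends with \<open>Z\<close>, so it splits. Its section followed by the projection \<open>f'\<close>
  to \<open>Y\<close> is the lift.\<close>

lemma lift_if_Ext1_zero:
  assumes c: "conflation C D X i Y p W" and f: "arr C f Z W" and E: "Ext1_zero C D Z X"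
  obtains g where "arr C g Z Y" "p \<bullet> g = f"
proof -
  obtain i' Y' p' f' where c': "conflation C D X i' Y' p' Z" "arr C f' Y' Y" "p \<bullet> f' = f \<bullet> p'"
    using pullback_conflation[OF c f] by metis
  then obtain s where s: "arr C s Z Y'" "p' \<bullet> s = Id C Z"
    using E unfolding Ext1_zero_def splits_def biproduct_def by blast
  have "p \<bullet> (f' \<bullet> s) = f"
    using comp_assoc[OF s(1) c'(2) conflation_arr(2)[OF c]] c'(3)
      comp_assoc[OF s(1) conflation_arr(2)[OF c'(1)] f] s(2) id_right[OF f] by simp
  then show thesis using that comp_arr[OF s(1) c'(2)] by blast
qed

lemma extend_if_Ext1_zero:
  assumes "conflation C D W i Y p Z" "arr C f W X" "Ext1_zero C D Z X"
  obtains g where "arr C g Y X" "g \<bullet> i = f"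
  using pre_exact_structure.lift_if_Ext1_zero[OF pre_exact_opposite, of Z p Y i W f X] assms
  by (auto simp: Ext1_zero_opposite)

text \<open>For injective \<open>I\<close>, the group of extensions of \<open>Z\<close> by
  \<open>X\<close> is the cokernel of the map from Hom(Z,I) to Hom(Z,W). To split a given
  conflation, extend \<open>j\<close> to \<open>g\<close> on its middle term, which induces
  \<open>h\<close> on the cokernels, and correct \<open>g\<close> by a lift of
  \<open>h\<close>.\<close>

lemma Ext1_zero_if_lift:
  assumes c: "conflation C D X j I q W" and I: "injective_obj C D I"
    and lift: "\<And>h. arr C h Z W \<Longrightarrow> \<exists>l. arr C l Z I \<and> q \<bullet> l = h"
  shows "Ext1_zero C D Z X"
  unfolding Ext1_zero_def
proof (intro allI impI)
  fix i Y p assume d: "conflation C D X i Y p Z"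
  have a: "arr C j X I" "arr C q I W" "arr C i X Y" "arr C p Y Z"
    using conflation_arr c d by auto
  have O: "X \<in> Obj C" "Y \<in> Obj C" "Z \<in> Obj C" "W \<in> Obj C" "I \<in> Obj C" using a arr_Obj by auto
  obtain g where g: "arr C g Y I" "g \<bullet> i = j"
    using extend_if_Ext1_zero[OF d a(1)] injective_obj_Ext1_zero[OF I] by metis
  have "(q \<bullet> g) \<bullet> i = \<zero>\<^bsub>Hom C X W\<^esub>"
    using comp_assoc[OF a(3) g(1) a(2)] g(2) conflation_comp_zero[OF c] by simp
  then obtain h where h: "arr C h Z W" "h \<bullet> p = q \<bullet> g"
    using conflation_cokernel[OF d comp_arr[OF g(1) a(2)]] by metis
  obtain l where l: "arr C l Z I" "q \<bullet> l = h" using lift[OF h(1)] by blast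
  have lp: "arr C (l \<bullet> p) Y I" using comp_arr[OF a(4) l(1)] .
  have qg: "arr C (q \<bullet> g) Y W" using comp_arr[OF g(1) a(2)] .
  \<comment> \<open>Subtracting \<open>l \<bullet> p\<close> does not change the restriction to
    \<open>X\<close>, since \<open>p \<bullet> i\<close> is zero, but makes the composite with
    \<open>q\<close> vanish. The difference thus factors through \<open>j\<close>, and the factor
    \<open>r\<close> is a retraction of \<open>i\<close>.\<close>
  let ?d = "g \<ominus>\<^bsub>Hom C Y I\<^esub> (l \<bullet> p)"
  have "q \<bullet> ?d = \<zero>\<^bsub>Hom C Y W\<^esub>"
    using comp_diff_right[OF g(1) lp a(2)] comp_assoc[OF a(4) l(1) a(2)] l(2) h(2)
      diff_eq_zero_iff[OF qg qg] by simp
  then obtain r where r: "arr C r Y X" "j \<bullet> r = ?d"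
    using conflation_kernel[OF c diff_arr[OF g(1) lp]] by metis
  have "(l \<bullet> p) \<bullet> i = \<zero>\<^bsub>Hom C X I\<^esub>"
    using comp_assoc[OF a(3,4) l(1)] conflation_comp_zero[OF d] comp_zero_right[OF l(1) O(1)] by simp
  then have "?d \<bullet> i = j"
    using comp_diff_left[OF a(3) g(1) lp] g(2) diff_zero[OF a(1)] by simp
  then have "j \<bullet> (r \<bullet> i) = j \<bullet> Id C X"
    using comp_assoc[OF a(3) r(1) a(1)] r(2) id_right[OF a(1)] by simp
  then have "r \<bullet> i = Id C X"
    using inflation_mono[OF c comp_arr[OF a(3) r(1)] id_arr[OF O(1)]] by simp
  then show "splits C X i Y p Z" using splits_if_retraction[OF d r(1)] by blast
qed

lemma Ext1_zero_if_extend: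
  assumes "conflation C D W k P q Z" "projective_obj C D P"
    and "\<And>h. arr C h W X \<Longrightarrow> \<exists>l. arr C l P X \<and> l \<bullet> k = h"
  shows "Ext1_zero C D Z X"
  using pre_exact_structure.Ext1_zero_if_lift[OF pre_exact_opposite, of Z q P k W X] assms
  by (simp add: Ext1_zero_opposite injective_obj_opposite)

section \<open>Vanishing of Ext in a conflation, in place of the long exact sequence\<close>

lemma Ext1_zero_extension:
  assumes c: "conflation C D X i Y p Z" and X: "Ext1_zero C D A X" and Z: "Ext1_zero C D A Z"
    and A: "A \<in> Obj C" and enough: "enough_projectives C D"
  shows "Ext1_zero C D A Y"
proof -
  obtain W k P q where d: "conflation C D W k P q A" and P: "projective_obj C D P"
    using A enough unfolding enough_projectives_def by blast
  have a: "arr C i X Y" "arr C p Y Z" "arr C k W P" "arr C q P A" using conflation_arr c d by auto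
  show ?thesis
  proof (rule Ext1_zero_if_extend[OF d P])
    fix h assume h: "arr C h W Y"
    have ph: "arr C (p \<bullet> h) W Z" using comp_arr[OF h a(2)] .
    \<comment> \<open>The extension of \<open>h\<close> over \<open>P\<close> is built in two
      stages: \<open>p \<bullet> h\<close> is extended to \<open>u\<close> and lifted to
      \<open>v\<close> by projectivity of \<open>P\<close>; the error of
      \<open>v \<bullet> k\<close> against \<open>h\<close> takes values in \<open>X\<close> and is
      extended separately by \<open>t\<close>.\<close>
    obtain u where u: "arr C u P Z" "u \<bullet> k = p \<bullet> h" using extend_if_Ext1_zero[OF d ph Z] by metis
    obtain v where v: "arr C v P Y" "p \<bullet> v = u"
      using lift_if_Ext1_zero[OF c u(1)] projective_obj_Ext1_zero[OF P] by metis
    have vk: "arr C (v \<bullet> k) W Y" using comp_arr[OF a(3) v(1)] .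
    let ?d = "h \<ominus>\<^bsub>Hom C W Y\<^esub> (v \<bullet> k)"
    have "p \<bullet> ?d = \<zero>\<^bsub>Hom C W Z\<^esub>"
      using comp_diff_right[OF h vk a(2)] comp_assoc[OF a(3) v(1) a(2)] u(2) v(2)
        diff_eq_zero_iff[OF ph ph] by simp
    then obtain w where w: "arr C w W X" "i \<bullet> w = ?d"
      using conflation_kernel[OF c diff_arr[OF h vk]] by metis
    obtain t where t: "arr C t P X" "t \<bullet> k = w" using extend_if_Ext1_zero[OF d w(1) X] by metis
    have it: "arr C (i \<bullet> t) P Y" using comp_arr[OF t(1) a(1)] .
    have "((i \<bullet> t) \<oplus>\<^bsub>Hom C P Y\<^esub> v) \<bullet> k = h"
      using comp_add_left[OF a(3) it v(1)] comp_assoc[OF a(3) t(1) a(1)] t(2) w(2)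
        diff_add_cancel[OF h vk] by simp
    then show "\<exists>l. arr C l P Y \<and> l \<bullet> k = h" using add_arr[OF it v(1)] by blast
  qed
qed

lemma Ext1_zero_extension':
  assumes "conflation C D X i Y p Z" "Ext1_zero C D X B" "Ext1_zero C D Z B"
    and "B \<in> Obj C" "enough_injectives C D"
  shows "Ext1_zero C D Y B"
  using pre_exact_structure.Ext1_zero_extension[OF pre_exact_opposite, of Z p Y i X B] assms
  by (simp add: Ext1_zero_opposite enough_projectives_opposite)

text \<open>This is dimension shifting: as \<open>K\<close> is a syzygy of \<open>A\<close>, the
  hypothesis on \<open>K\<close> and \<open>X\<close> expresses that the second Ext of
  \<open>A\<close> and \<open>X\<close> vanishes. Concretely, \<open>h\<close> is lifted to
  \<open>Y\<close>, extended over \<open>P\<close>, and mapped back to \<open>Z\<close>.\<close>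

lemma Ext1_zero_cokernel:
  assumes c: "conflation C D X i Y p Z" and Y: "Ext1_zero C D A Y"
    and d: "conflation C D K k P q A" and P: "projective_obj C D P" and K: "Ext1_zero C D K X"
  shows "Ext1_zero C D A Z"
proof (rule Ext1_zero_if_extend[OF d P])
  fix h assume h: "arr C h K Z"
  obtain g where g: "arr C g K Y" "p \<bullet> g = h" using lift_if_Ext1_zero[OF c h K] by metis
  obtain l where l: "arr C l P Y" "l \<bullet> k = g" using extend_if_Ext1_zero[OF d g(1) Y] by metis
  have "(p \<bullet> l) \<bullet> k = h"
    using comp_assoc[OF conflation_arr(1)[OF d] l(1) conflation_arr(2)[OF c]] l g by simp
  then show "\<exists>l. arr C l P Z \<and> l \<bullet> k = h" using comp_arr[OF l(1) conflation_arr(2)[OF c]] by blast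
qed

text \<open>The dual dimension shift, with the cosyzygy \<open>L\<close> of \<open>B\<close> in
  place of a syzygy.\<close>

lemma Ext1_zero_kernel:
  assumes "conflation C D X i Y p Z" "Ext1_zero C D Y B"
    and "conflation C D B j I q L" "injective_obj C D I" "Ext1_zero C D Z L"
  shows "Ext1_zero C D X B"
  using pre_exact_structure.Ext1_zero_cokernel[OF pre_exact_opposite, of Z p Y i X B L q I j] assms
  by (simp add: Ext1_zero_opposite projective_obj_opposite)


section \<open>Divisible objects of a projectively generated structure\<close>

text \<open>Left exactness of Hom(N,-) is the kernel property of \<open>i\<close>; surjectivity on
  the right is the hypothesis \<open>lift\<close>.\<close>

lemma conflation_short_exact:
  assumes c: "conflation C D X i Y p Z" and N: "N \<in> Obj C"
    and lift: "\<And>f. arr C f N Z \<Longrightarrow> \<exists>g. arr C g N Y \<and> p \<bullet> g = f"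
  shows "short_exact_sequence
           (add_monoid (Hom C N Z)) (add_monoid (Hom C N Y)) (add_monoid (Hom C N X))
           (\<lambda>g. p \<bullet> g) (\<lambda>f. i \<bullet> f)"
proof -
  have a: "arr C i X Y" "arr C p Y Z" using conflation_arr c by auto
  have O: "X \<in> Obj C" "Y \<in> Obj C" "Z \<in> Obj C" using a arr_Obj by auto
  have arrI: "arr C f N W" if "f \<in> carrier (Hom C N W)" "W \<in> Obj C" for f W
    using that N by (simp add: arr_def)
  have gr: "group (add_monoid (Hom C N W))" if "W \<in> Obj C" for W
    using abelian_group.a_group[OF hom_abelian[OF N that]] .
  have hom: "(\<lambda>g. u \<bullet> g) \<in> hom (add_monoid (Hom C N V)) (add_monoid (Hom C N W))"
    if u: "arr C u V W" for u V W
  proof (rule homI)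
    have VW: "V \<in> Obj C" "W \<in> Obj C" using arr_Obj[OF u] by auto
    fix x y assume "x \<in> carrier (add_monoid (Hom C N V))" "y \<in> carrier (add_monoid (Hom C N V))"
    then have xy: "arr C x N V" "arr C y N V" using arrI VW by auto
    show "u \<bullet> x \<in> carrier (add_monoid (Hom C N W))"
      using comp_arr[OF xy(1) u] by (simp add: arr_def)
    show "u \<bullet> (x \<otimes>\<^bsub>add_monoid (Hom C N V)\<^esub> y) = (u \<bullet> x) \<otimes>\<^bsub>add_monoid (Hom C N W)\<^esub> (u \<bullet> y)"
      using comp_add_right[OF xy u] by simp
  qed
  have ker: "kernel (add_monoid (Hom C N Y)) (add_monoid (Hom C N Z)) (\<lambda>g. p \<bullet> g)
      = (\<lambda>f. i \<bullet> f) ` carrier (add_monoid (Hom C N X))" (is "?K = ?I")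
  proof
    show "?K \<subseteq> ?I"
    proof
      fix g assume "g \<in> ?K"
      then have g: "arr C g N Y" "p \<bullet> g = \<zero>\<^bsub>Hom C N Z\<^esub>" using arrI O by (auto simp: kernel_def)
      then obtain h where "arr C h N X" "i \<bullet> h = g" using conflation_kernel[OF c] by metis
      then show "g \<in> ?I" by (auto simp: arr_def)
    qed
    show "?I \<subseteq> ?K"
    proof
      fix g assume "g \<in> ?I"
      then obtain h where h: "arr C h N X" "g = i \<bullet> h" using arrI O by auto
      have "p \<bullet> g = \<zero>\<^bsub>Hom C N Z\<^esub>"
        using comp_assoc[OF h(1) a] h(2) conflation_comp_zero[OF c] comp_zero_left[OF h(1) O(3)] by simp
      then show "g \<in> ?K" using comp_arr[OF h(1) a(1)] h(2) by (simp add: kernel_def arr_def)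
    qed
  qed
  have "inj_on (\<lambda>f. i \<bullet> f) (carrier (Hom C N X))"
    using inflation_mono[OF c arrI arrI] O by (blast intro: inj_onI)
  moreover have "(\<lambda>g. p \<bullet> g) ` carrier (Hom C N Y) = carrier (Hom C N Z)"
  proof
    show "(\<lambda>g. p \<bullet> g) ` carrier (Hom C N Y) \<subseteq> carrier (Hom C N Z)"
      using hom[OF a(2)] by (auto simp: hom_def)
    show "carrier (Hom C N Z) \<subseteq> (\<lambda>g. p \<bullet> g) ` carrier (Hom C N Y)"
    proof
      fix f assume "f \<in> carrier (Hom C N Z)"
      then obtain g where "arr C g N Y" "p \<bullet> g = f" using lift arrI O by blast
      then show "f \<in> (\<lambda>g. p \<bullet> g) ` carrier (Hom C N Y)" by (auto simp: arr_def)
    qed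
  qed
  ultimately show ?thesis
    unfolding short_exact_sequence_iff epi_def mon_def
    using hom[OF a(1)] hom[OF a(2)] gr O ker by (simp add: group_hom_def group_hom_axioms_def)
qed

text \<open>If extensions by \<open>X\<close> split, morphisms from objects of \<N> lift along the
  cokernel of every inflation of \<open>X\<close>. Conversely, for a conflation that ends in an
  object of \<N>, lifting the identity of that object gives a section.\<close>

lemma divisible_projectively_generated:
  assumes N: "\<N> \<subseteq> Obj C"
  shows "divisible_objs C D (projectively_generated C D \<N>)
    = {X \<in> Obj C. \<forall>N \<in> \<N>. Ext1_zero C D N X}" (is "?L = ?R")
proof
  show "?L \<subseteq> ?R"
  proof
    fix X assume X: "X \<in> ?L"
    have "splits C X i Y p N" if NN: "N \<in> \<N>" and c: "conflation C D X i Y p N" for N i Y p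
    proof -
      have "inflation C (projectively_generated C D \<N>) i X Y"
        using X c unfolding divisible_objs_def inflation_def by blast
      then obtain p' Z where "conflation C (projectively_generated C D \<N>) X i Y p' Z"
        by (auto simp: inflation_def)
      then obtain X\<^sub>1 Y\<^sub>1 Z\<^sub>1 where E: "arr C i X Y" "conflation C D X\<^sub>1 i Y\<^sub>1 p' Z\<^sub>1"
          and ses: "\<forall>N \<in> \<N>. short_exact_sequence
           (add_monoid (Hom C N Z\<^sub>1)) (add_monoid (Hom C N Y\<^sub>1)) (add_monoid (Hom C N X\<^sub>1))
           (\<lambda>g. p' \<bullet> g) (\<lambda>f. i \<bullet> f)"
        unfolding conflation_def projectively_generated_def by blast
      have "X\<^sub>1 = X" "Y\<^sub>1 = Y" using hom_disjoint E conflation_arr(1) by metis+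
      then have c': "conflation C D X i Y p' Z\<^sub>1" using E by simp
      have surj: "(\<lambda>g. p' \<bullet> g) ` carrier (Hom C N Y) = carrier (Hom C N Z\<^sub>1)"
        using ses NN \<open>Y\<^sub>1 = Y\<close> unfolding short_exact_sequence_iff epi_def by auto
      \<comment> \<open>Divisibility provides a generated conflation that shares only the inflation
        \<open>i\<close>; its deflation \<open>p'\<close> may differ from \<open>p\<close>. Both are
        cokernels of \<open>i\<close>, which gives the comparison morphisms \<open>u\<close> and
        \<open>v\<close>.\<close>
      obtain u where u: "arr C u N Z\<^sub>1" "u \<bullet> p = p'"
        using conflation_cokernel[OF c conflation_arr(2)[OF c'] conflation_comp_zero[OF c']] by metis
      obtain v where v: "arr C v Z\<^sub>1 N" "v \<bullet> p' = p"
        using conflation_cokernel[OF c' conflation_arr(2)[OF c] conflation_comp_zero[OF c]] by metis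
      have a: "arr C p Y N" "arr C p' Y Z\<^sub>1" using conflation_arr c c' by auto
      have O: "N \<in> Obj C" "Y \<in> Obj C" using arr_Obj a by auto
      have "(v \<bullet> u) \<bullet> p = Id C N \<bullet> p"
        using comp_assoc[OF a(1) u(1) v(1)] u v id_left[OF a(1)] by simp
      then have vu: "v \<bullet> u = Id C N"
        using deflation_epi[OF c comp_arr[OF u(1) v(1)] id_arr[OF O(1)]] by simp
      \<comment> \<open>A lift \<open>s\<close> of \<open>u\<close> along \<open>p'\<close> is a
        section of \<open>p\<close>, because \<open>p \<bullet> s\<close> equals
        \<open>v \<bullet> u\<close>.\<close>
      have "u \<in> (\<lambda>g. p' \<bullet> g) ` carrier (Hom C N Y)" using surj u(1) by (simp add: arr_def)
      then obtain s where "s \<in> carrier (Hom C N Y)" "u = p' \<bullet> s" by (rule imageE)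
      then have s: "arr C s N Y" "p' \<bullet> s = u" using O by (simp_all add: arr_def)
      have "p \<bullet> s = Id C N" using comp_assoc[OF s(1) a(2) v(1)] s v vu by simp
      then show ?thesis using splits_if_section[OF c s(1)] by blast
    qed
    then show "X \<in> ?R" using X by (auto simp: divisible_objs_def Ext1_zero_def)
  qed
  show "?R \<subseteq> ?L"
  proof
    fix X assume X: "X \<in> ?R"
    have "inflation C (projectively_generated C D \<N>) i X Y" if infl: "inflation C D i X Y" for i Y
    proof -
      obtain p Z where c: "conflation C D X i Y p Z"
        using infl unfolding inflation_def by blast
      have "short_exact_sequence
           (add_monoid (Hom C N Z)) (add_monoid (Hom C N Y)) (add_monoid (Hom C N X))
           (\<lambda>g. p \<bullet> g) (\<lambda>f. i \<bullet> f)" if NN: "N \<in> \<N>" for N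
      proof (rule conflation_short_exact[OF c])
        show "N \<in> Obj C" using N NN by blast
        have E: "Ext1_zero C D N X" using X NN by blast
        show "\<exists>g. arr C g N Y \<and> p \<bullet> g = f" if "arr C f N Z" for f
          by (rule lift_if_Ext1_zero[OF c that E]) blast
      qed
      then have "(i, p) \<in> projectively_generated C D \<N>"
        using c unfolding projectively_generated_def by blast
      then show ?thesis using conflation_arr[OF c] by (auto simp: inflation_def conflation_def)
    qed
    then show "X \<in> ?L" using X by (auto simp: divisible_objs_def)
  qed
qed


section \<open>Cotorsion pairs\<close>

lemma coresolving_imp_resolving:
  assumes "cotorsion_pair C D \<A> \<B>" and enough: "enough_injectives C D" "enough_projectives C D"
    and cores: "coresolving C D \<B>"
  shows "resolving C D \<A>"
proof -
  have A: "\<A> = {X \<in> Obj C. \<forall>B \<in> \<B>. Ext1_zero C D X B}" and B: "\<B> \<subseteq> Obj C"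
    using assms(1) unfolding cotorsion_pair_def by - (elim conjE, assumption)+
  have "P \<in> \<A>" if "projective_obj C D P" for P
    using that projective_obj_Ext1_zero[OF that] unfolding A by (simp add: projective_obj_def)
  moreover have "Y \<in> \<A>" if c: "conflation C D X i Y p Z" and XZ: "X \<in> \<A>" "Z \<in> \<A>" for X i Y p Z
  proof -
    have "Ext1_zero C D Y S" if "S \<in> \<B>" for S
      using Ext1_zero_extension'[OF c _ _ _ enough(1)] XZ that A B by blast
    then show ?thesis using conflation_Obj[OF c] unfolding A by simp
  qed
  moreover have "X \<in> \<A>" if c: "conflation C D X i Y p Z" and YZ: "Y \<in> \<A>" "Z \<in> \<A>" for X i Y p Z
  proof -
    have "Ext1_zero C D X S" if S: "S \<in> \<B>" for S
    proof -
      obtain j I q L where d: "conflation C D S j I q L" and I: "injective_obj C D I"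
        using S B enough unfolding enough_injectives_def by blast
      \<comment> \<open>The injective \<open>I\<close> belongs to \<B>, so the cokernel
        \<open>L\<close> of \<open>S\<close> in \<open>I\<close> does too; this makes dimension
        shifting in the second variable possible.\<close>
      have "L \<in> \<B>" using cores d I S unfolding coresolving_def by blast
      then show ?thesis using Ext1_zero_kernel[OF c _ d I] YZ S A by blast
    qed
    then show ?thesis using conflation_Obj[OF c] unfolding A by simp
  qed
  ultimately show ?thesis unfolding resolving_def extension_closed_def by blast
qed

text \<open>Since \<B> is the right orthogonal class of \<N>, membership in \<B> has to be tested
  only against \<N>, and dimension shifting then involves only the syzygies of the objects of
  \<N>.\<close>

lemma coresolving_iff_syzygies:
  assumes pair: "cotorsion_pair C D \<A> \<B>"
    and enough: "enough_injectives C D" "enough_projectives C D"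
    and N: "\<N> \<subseteq> Obj C" and div: "\<B> = divisible_objs C D (projectively_generated C D \<N>)"
  shows "coresolving C D \<B> \<longleftrightarrow>
    (\<forall>Z i U p V. conflation C D Z i U p V \<and> V \<in> \<N> \<and> projective_obj C D U \<longrightarrow> Z \<in> \<A>)"
    (is "_ \<longleftrightarrow> ?syz")
proof
  have A: "\<A> = {X \<in> Obj C. \<forall>B \<in> \<B>. Ext1_zero C D X B}"
    and B: "\<B> = {X \<in> Obj C. \<forall>A \<in> \<A>. Ext1_zero C D A X}"
    using pair unfolding cotorsion_pair_def by - (elim conjE, assumption)+
  have BN: "\<B> = {X \<in> Obj C. \<forall>N \<in> \<N>. Ext1_zero C D N X}"
    using divisible_projectively_generated[OF N] div by simp
  {
    assume "coresolving C D \<B>"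
    then have "resolving C D \<A>" by (rule coresolving_imp_resolving[OF pair enough])
    \<comment> \<open>With \<open>V\<close> and the projective \<open>U\<close> both in \<A>, the
      kernel \<open>Z\<close> of the deflation between them lies in the resolving class
      \<A>.\<close>
    moreover have "\<N> \<subseteq> \<A>"
    proof
      fix V assume "V \<in> \<N>"
      then show "V \<in> \<A>" using N BN unfolding A by blast
    qed
    ultimately show ?syz unfolding resolving_def by blast
  next
    assume syz: ?syz
    have "I \<in> \<B>" if "injective_obj C D I" for I
      using that injective_obj_Ext1_zero[OF that] unfolding B by (simp add: injective_obj_def)
    moreover have "Y \<in> \<B>" if c: "conflation C D X i Y p Z" and XZ: "X \<in> \<B>" "Z \<in> \<B>" for X i Y p Z
    proof -
      have "Ext1_zero C D V Y" if "V \<in> \<N>" for V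
        using Ext1_zero_extension[OF c _ _ _ enough(2)] XZ that N BN by blast
      then show ?thesis using conflation_Obj[OF c] unfolding BN by simp
    qed
    moreover have "Z \<in> \<B>" if c: "conflation C D X i Y p Z" and XY: "X \<in> \<B>" "Y \<in> \<B>" for X i Y p Z
    proof -
      have "Ext1_zero C D V Z" if V: "V \<in> \<N>" for V
      proof -
        \<comment> \<open>A projective presentation of \<open>V\<close> makes \<open>K\<close> one
          of the syzygies covered by the hypothesis, so extensions of \<open>K\<close> by
          \<open>X\<close> split.\<close>
        obtain K k P q where d: "conflation C D K k P q V" and P: "projective_obj C D P"
          using V N enough unfolding enough_projectives_def by blast
        have "K \<in> \<A>" using syz d P V by blast
        then have "Ext1_zero C D K X" using XY A by blast
        moreover have "Ext1_zero C D V Y" using XY V BN by blast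
        ultimately show ?thesis using Ext1_zero_cokernel[OF c _ d P] by blast
      qed
      then show ?thesis using conflation_Obj[OF c] unfolding BN by simp
    qed
    ultimately show "coresolving C D \<B>" unfolding coresolving_def extension_closed_def by blast
  }
qed

end

section \<open>Cotorsion pairs and generated structures in the opposite category\<close>

context preadditive_category
begin

lemma cotorsion_pair_opposite:
  "cotorsion_pair (opposite C) (D\<inverse>) \<B> \<A> \<longleftrightarrow> cotorsion_pair C D \<A> \<B>"
  unfolding cotorsion_pair_def Ext1_zero_opposite opposite_simps by blast

lemma coresolving_opposite: "coresolving (opposite C) (D\<inverse>) K \<longleftrightarrow> resolving C D K"
  unfolding coresolving_def resolving_def extension_closed_def injective_obj_opposite
    conflation_opposite by blast

lemma resolving_opposite: "resolving (opposite C) (D\<inverse>) K \<longleftrightarrow> coresolving C D K"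
  unfolding coresolving_def resolving_def extension_closed_def projective_obj_opposite
    conflation_opposite by blast

lemma projectively_generated_opposite:
  "projectively_generated (opposite C) (D\<inverse>) \<M> = (injectively_generated C D \<M>)\<inverse>"
proof -
  \<comment> \<open>The equation is stated for the unapplied operation, because the map
    \<open>\<lambda>g. p \<bullet> g\<close> is by eta-contraction a partial application of
    \<open>Comp\<close>.\<close>
  have "Comp (opposite C) = (\<lambda>g f. f \<bullet> g)" by (simp add: opposite_def)
  then show ?thesis
    unfolding projectively_generated_def injectively_generated_def by (auto; blast)
qed

lemma divisible_objs_opposite: "divisible_objs (opposite C) (D\<inverse>) (E\<inverse>) = flat_objs C D E"
  by (simp add: divisible_objs_def flat_objs_def)

end

theorem corollary4p5:
  fixes C :: "('o, 'm) add_cat"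
    and D E E' :: "('m \<times> 'm) set"
    and \<A> \<B> \<N> \<M> :: "'o set"
  assumes "additive_category C"
    and "exact_structure C D"
    and "cotorsion_pair C D \<A> \<B>"
    and "enough_injectives C D"
    and "enough_projectives C D"
    and "\<N> \<subseteq> Obj C"
    and "exact_structure C E"
    and "E = projectively_generated C D \<N>"
    and "\<B> = divisible_objs C D E"
    and "\<M> \<subseteq> Obj C"
    and "exact_structure C E'"
    and "E' = injectively_generated C D \<M>"
    and "\<A> = flat_objs C D E'"
  shows "(coresolving C D \<B> \<longleftrightarrow>
            (\<forall>Z i U p V. conflation C D Z i U p V \<and> V \<in> \<N> \<and> projective_obj C D U
               \<longrightarrow> Z \<in> \<A>)) \<and>
         (coresolving C D \<B> \<longleftrightarrow> resolving C D \<A>) \<and>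
         (coresolving C D \<B> \<longleftrightarrow>
            (\<forall>X i Y' p Z'. conflation C D X i Y' p Z' \<and> X \<in> \<M> \<and> injective_obj C D Y'
               \<longrightarrow> Z' \<in> \<B>))"
proof -
  interpret D: pre_exact_structure C D using exact_structure.pre_exact assms(2) .
  interpret op: pre_exact_structure "opposite C" "D\<inverse>" by (rule D.pre_exact_opposite)
  \<comment> \<open>In the opposite category \<A> and \<B> exchange their roles and \<M> takes the
    place of \<N>.\<close>
  note pair_op = D.cotorsion_pair_opposite[THEN iffD2, OF assms(3)]
  note enough_op = D.enough_injectives_opposite[THEN iffD2, OF assms(5)]
    D.enough_projectives_opposite[THEN iffD2, OF assms(4)]
  have syz: "coresolving C D \<B> \<longleftrightarrow>
    (\<forall>Z i U p V. conflation C D Z i U p V \<and> V \<in> \<N> \<and> projective_obj C D U \<longrightarrow> Z \<in> \<A>)"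
    using D.coresolving_iff_syzygies[OF assms(3-6)] assms(8,9) by simp
  have "\<A> = divisible_objs (opposite C) (D\<inverse>) (projectively_generated (opposite C) (D\<inverse>) \<M>)"
    using assms(12,13) by (simp add: D.projectively_generated_opposite D.divisible_objs_opposite)
  then have "resolving C D \<A> \<longleftrightarrow>
    (\<forall>Z' p Y' i X. conflation C D X i Y' p Z' \<and> X \<in> \<M> \<and> injective_obj C D Y' \<longrightarrow> Z' \<in> \<B>)"
    using op.coresolving_iff_syzygies[OF pair_op enough_op, of \<M>] assms(10)
    by (simp add: D.coresolving_opposite D.projective_obj_opposite)
  \<comment> \<open>One implication is proved directly; the other is the same implication for the
    opposite pair.\<close>
  moreover have "coresolving C D \<B> \<longleftrightarrow> resolving C D \<A>"
    using D.coresolving_imp_resolving[OF assms(3-5)]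
      op.coresolving_imp_resolving[OF pair_op enough_op]
    by (auto simp: D.coresolving_opposite D.resolving_opposite)
  ultimately show ?thesis using syz by blast
qed

end
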